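(* Suppose there exists an $(X,Y)$-only algorithm that allocates $\boldsymbol Z(t)$ and $\boldsymbol P(t)$ so that, for some given values $\hat r$ and $\hat\mu_m$, $m\in\{1,\ldots,M\}$, $$\sum_{k=1}^K\mathbb{E}\{Z_k(t)(P_k(t)-\alpha_k)F_k(P_k(t),Y(t))\}\ge\hat r,$$ $$\sum_{k=1}^K\beta_{mk}\mathbb{E}\{Z_k(t)F_k(P_k(t),Y(t))\}\le\hat\mu_m\quad\text{for all }m\in\{1,\ldots,M\}.$$ Then the same inequality constraints can be achieved by a new stationary randomized policy $\boldsymbol Z^*(t),\boldsymbol P^*(t)$ that uses at most two prices for each unique product $k\in\{1,\ldots,K\}$ and each unique demand state $Y(t)\in\mathcal Y$.
   Context: There are $M$ raw materials and $K$ products; $\beta_{mk}$ is the nonnegative integer number of units of material $m$ needed for one unit of product $k$, and $\alpha_k\ge0$ is the cost of assembling one unit of product $k$. The supply state $X(t)$ and the demand state $Y(t)$ take values in finite or countably infinite sets $\mathcal X$ and $\mathcal Y$ and are stationary, with $Pr[X(t)=x]=\pi(x)$ and $Pr[Y(t)=y]=\pi(y)$. For each product $k$, the plant chooses an offer variable $Z_k(t)\in\{0,1\}$ and a price $P_k(t)\in\mathcal P_k$, where $\mathcal P_k$ is a compact set of nonnegative reals; $\boldsymbol Z(t)=(Z_1(t),\ldots,Z_K(t))$, $\boldsymbol P(t)=(P_1(t),\ldots,P_K(t))$. The demand $D_k(t)$ for product $k$ is a random integer in $[0,D_{k,max}]$ ($D_{k,max}$ finite) with $F_k(p,y)=\mathbb{E}\{D_k(t)\mid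 P_k(t)=p,Y(t)=y\}$, where $F_k(p,y)$ is continuous in $p\in\mathcal P_k$ for each $y\in\mathcal Y$. A policy is called *$(X,Y)$-only* if it chooses its decisions on each slot as a stationary and randomized function only of the currently observed states $X(t)$ and $Y(t)$. Expectations are with respect to the stationary distributions of $X(t),Y(t)$ and the randomization of the policy. "Uses at most two prices for each product $k$ and each demand state $y$" means that, given $Y(t)=y$, the price $P_k^*(t)$ takes values in a set of at most two elements of $\mathcal P_k$ depending only on $(k,y)$. *)

theory Defs
  imports "HOL-Probability.Probability"
begin

text \<open>
  The stationary joint distribution of supply and demand state in a slot is a pmf on
  \<open>'x \<times> 'y\<close>, whose marginals are the two state distributions; \<open>X(t)\<close> and \<open>Y(t)\<close> need not be
  independent.  The action taken in a slot is a pair \<open>(z, p)\<close> of an offer vector and a price vector,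
  indexed by the products \<open>{1..K}\<close>.  The price factor is the Borel space of \<open>P k\<close> itself, so nothing
  is required of demand functions at prices outside \<open>P k\<close>.
\<close>

definition action_space ::
    "nat \<Rightarrow> (nat \<Rightarrow> real set) \<Rightarrow> ((nat \<Rightarrow> nat) \<times> (nat \<Rightarrow> real)) measure" where
  "action_space K P =
     (\<Pi>\<^sub>M k\<in>{1..K}. count_space {0, 1}) \<Otimes>\<^sub>M (\<Pi>\<^sub>M k\<in>{1..K}. restrict_space borel (P k))"

text \<open>
  A stationary randomized function of the current states is a stochastic kernel into the action
  space; given the states, offers and prices of different products may be correlated.
\<close>

definition xy_only_policy ::
    "nat \<Rightarrow> (nat \<Rightarrow> real set) \<Rightarrow> ('x \<times> 'y \<Rightarrow> ((nat \<Rightarrow> nat) \<times> (nat \<Rightarrow> real)) measure) \<Rightarrow> bool" where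
  "xy_only_policy K P q \<longleftrightarrow> q \<in> count_space UNIV \<rightarrow>\<^sub>M prob_algebra (action_space K P)"

text \<open>Joint law of \<open>((X(t), Y(t)), (Z(t), P(t)))\<close> under the policy \<open>q\<close>.\<close>

definition slot_law ::
    "('x \<times> 'y) pmf \<Rightarrow> ('x \<times> 'y \<Rightarrow> ((nat \<Rightarrow> nat) \<times> (nat \<Rightarrow> real)) measure)
      \<Rightarrow> (('x \<times> 'y) \<times> ((nat \<Rightarrow> nat) \<times> (nat \<Rightarrow> real))) measure" where
  "slot_law J q = measure_pmf J \<bind> (\<lambda>s. return (count_space UNIV) s \<Otimes>\<^sub>M q s)"

text \<open>
  The price sets \<open>S k y\<close> may depend on the product and the demand state, but not on the supply
  state; the condition is imposed on every state, also on those of probability zero.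
\<close>

definition uses_at_most_two_prices ::
    "nat \<Rightarrow> (nat \<Rightarrow> real set) \<Rightarrow> ('x \<times> 'y \<Rightarrow> ((nat \<Rightarrow> nat) \<times> (nat \<Rightarrow> real)) measure) \<Rightarrow> bool" where
  "uses_at_most_two_prices K P q \<longleftrightarrow>
     (\<exists>S :: nat \<Rightarrow> 'y \<Rightarrow> real set. \<forall>k\<in>{1..K}. \<forall>y.
        S k y \<subseteq> P k \<and> finite (S k y) \<and> card (S k y) \<le> 2 \<and>
        (\<forall>x. AE (z, p) in q (x, y). p k \<in> S k y))"

end

theory Submission
  imports Defs
begin

text \<open>
  Fix a product and a demand state. On the slots with that demand state the given policy earns some
  revenue from the product and causes some demand for it; per unit of offering probability both are
  means of continuous functions \<open>g\<close> (revenue) and \<open>h\<close> (demand) of the random price. A mean of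
  \<open>(g, h)\<close> over a compact price set is dominated by a mixture of two prices, one with at least the same \<open>g\<close>
  and at most the same \<open>h\<close>: the mean revenue under a bound on mean demand is a linear programme
  with one constraint besides normalisation, so an optimal solution needs two atoms. Here this is
  proved by Lagrangian duality. Compactness gives a best two-point mixture; its optimality against
  pairs of prices on either side of the constraint provides a multiplier, and the resulting
  pointwise inequality is integrated against the given price law
  (\<open>optimal_two_point_mixture_multiplier\<close>, \<open>two_point_mixture_dominates_weighted_mean\<close>).

  The lottery has to depend on the demand state only, whereas the given price law also depends on the
  supply state and is correlated with the offers. The comparison is therefore made for the law of
  the whole slot, with the offer variable, restricted to one demand state, as a weight on the price. The new
  policy keeps the law of the offers in every state and draws the prices afresh and independently of
  them, so that revenue and demand factor into offer times lottery mean
  (\<open>two_price_redraw_policy\<close>). Objective and constraints are sums over products and add up over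
  demand states; hence the comparison for a single product and demand state suffices. As the material
  requirements are nonnegative, lowering the mean demand for each product meets all material
  constraints at once.
\<close>

section \<open>Domination of a mean by a mixture of two points\<close>

text \<open>
  The best mixture \<open>V\<close> is compared with the mixture of two points \<open>p\<close>, \<open>p'\<close> on opposite sides of
  \<open>h = c\<close> that meets the constraint with equality: in the plane of \<open>(h, g)\<close> the slope from
  \<open>(c, V)\<close> to \<open>p'\<close> never exceeds the slope from \<open>p\<close> to \<open>(c, V)\<close>. Any number between all
  the former and all the latter slopes is a multiplier. Without a point strictly below \<open>c\<close> the slopes to the right may be unbounded, which is why the
  multiplier is claimed only under that condition and the points with \<open>h p = c\<close> get a claim
  of their own.
\<close>

lemma optimal_two_point_mixture_multiplier:
  fixes g h :: "'a::metric_space \<Rightarrow> real"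
  assumes S: "compact S" and g: "continuous_on S g" and h: "continuous_on S h"
    and feas: "s \<in> S" "h s \<le> c"
  obtains a b \<theta> where "a \<in> S" "b \<in> S" "0 \<le> \<theta>" "\<theta> \<le> 1" "\<theta> * h a + (1 - \<theta>) * h b \<le> c"
    "\<And>p. p \<in> S \<Longrightarrow> h p = c \<Longrightarrow> g p \<le> \<theta> * g a + (1 - \<theta>) * g b"
    "(\<exists>p\<in>S. h p < c) \<Longrightarrow>
       \<exists>l. \<forall>p\<in>S. g p - (\<theta> * g a + (1 - \<theta>) * g b) \<le> l * (h p - c)"
proof -
  define mix where "mix f t = snd t * f (fst (fst t)) + (1 - snd t) * f (snd (fst t))"
    for f :: "'a \<Rightarrow> real" and t :: "('a \<times> 'a) \<times> real"
  define D where "D = (S \<times> S) \<times> {0..1::real}"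
  have mix_cont: "continuous_on D (mix f)" if "continuous_on S f" for f
    unfolding mix_def D_def
    by (intro continuous_intros continuous_on_compose2[OF that]) auto
  have D_compact: "compact D"
    unfolding D_def by (intro compact_Times S) auto
  define T where "T = {t \<in> D. mix h t \<le> c}"
  have "closedin (top_of_set D) (D \<inter> mix h -` {..c})"
    by (rule continuous_closedin_preimage[OF mix_cont[OF h]]) auto
  moreover have "D \<inter> mix h -` {..c} = T" by (auto simp: T_def)
  ultimately have T_compact: "compact T"
    using D_compact by (metis closedin_compact)
  have "((s, s), 1) \<in> T" using feas by (auto simp: T_def D_def mix_def)
  then have "T \<noteq> {}" by auto
  moreover have "continuous_on T (mix g)"
    by (rule continuous_on_subset[OF mix_cont[OF g]]) (auto simp: T_def)
  ultimately obtain t where t: "t \<in> T" and t_max: "\<And>t'. t' \<in> T \<Longrightarrow> mix g t' \<le> mix g t"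
    using continuous_attains_sup[OF T_compact] by blast
  define V where "V = mix g t"
  have pure: "g p \<le> V" if "p \<in> S" "h p \<le> c" for p
    using t_max[of "((p, p), 1)"] that by (auto simp: T_def D_def mix_def V_def)
  have crossing: "(g p' - V) / (h p' - c) \<le> (V - g p) / (c - h p)"
    if p: "p \<in> S" "h p < c" and p': "p' \<in> S" "c < h p'" for p p'
  proof -
    \<comment> \<open>the weight at which the mixture of \<open>p\<close> and \<open>p'\<close> meets the constraint with equality\<close>
    define \<tau> where "\<tau> = (h p' - c) / (h p' - h p)"
    have \<tau>: "0 \<le> \<tau>" "\<tau> \<le> 1" "1 - \<tau> = (c - h p) / (h p' - h p)"
      using p p' by (auto simp: \<tau>_def divide_simps)
    have pos: "h p' - h p > 0" using p p' by simp
    have "mix h ((p, p'), \<tau>) = c"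
      unfolding mix_def fst_conv snd_conv \<tau>(3) using pos
      by (simp add: \<tau>_def divide_simps) (simp add: algebra_simps)
    then have "mix g ((p, p'), \<tau>) \<le> V"
      unfolding V_def using p p' \<tau> by (intro t_max) (auto simp: T_def D_def)
    then have "(h p' - c) * g p + (c - h p) * g p' \<le> V * (h p' - h p)"
      unfolding mix_def fst_conv snd_conv \<tau>(3) using pos
      by (simp add: \<tau>_def divide_simps)
    then show ?thesis
      using p p' by (simp add: divide_simps) (simp add: algebra_simps)
  qed
  have multiplier: "\<exists>l. \<forall>p\<in>S. g p - V \<le> l * (h p - c)" if ex: "\<exists>p\<in>S. h p < c"
  proof -
    \<comment> \<open>the slopes from the left; their infimum still dominates all slopes to the right\<close>
    define R where "R = (\<lambda>p. (V - g p) / (c - h p)) ` {p \<in> S. h p < c}"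
    have R: "R \<noteq> {}" using ex by (auto simp: R_def)
    have R_nonneg: "0 \<le> r" if "r \<in> R" for r
      using that pure by (auto simp: R_def intro!: divide_nonneg_nonneg)
    have bdd: "bdd_below R" using R_nonneg by (rule bdd_belowI)
    have "g p - V \<le> Inf R * (h p - c)" if p: "p \<in> S" for p
    proof (cases "h p" c rule: linorder_cases)
      case less
      then have "Inf R \<le> (V - g p) / (c - h p)"
        using p by (intro cInf_lower[OF _ bdd]) (auto simp: R_def)
      then show ?thesis using less by (simp add: field_simps)
    next
      case equal
      then show ?thesis using pure[OF p] by simp
    next
      case greater
      then have "(g p - V) / (h p - c) \<le> Inf R"
        using p crossing by (intro cInf_greatest[OF R]) (auto simp: R_def)
      then show ?thesis using greater by (simp add: field_simps)
    qed
    then show ?thesis by blast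
  qed
  obtain a b \<theta> where t_eq: "t = ((a, b), \<theta>)" by (metis prod.exhaust)
  show thesis
  proof (rule that)
    show "a \<in> S" "b \<in> S" "0 \<le> \<theta>" "\<theta> \<le> 1" "\<theta> * h a + (1 - \<theta>) * h b \<le> c"
      using t by (auto simp: t_eq T_def D_def mix_def)
  qed (use pure multiplier in \<open>auto simp: V_def t_eq mix_def\<close>)
qed

text \<open>
  The weighted means are compared by integrating the multiplier inequality at \<open>c\<close>, the normalised
  weighted mean of \<open>h\<close>: the term of the multiplier then integrates to zero. The means are left
  unnormalised, so that a weight vanishing almost everywhere (a product never offered in
  some demand state, or a demand state of probability zero) is covered.
\<close>

lemma two_point_mixture_dominates_weighted_mean:
  fixes g h :: "'a::metric_space \<Rightarrow> real" and w :: "'b \<Rightarrow> real"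
  assumes S: "compact S" "S \<noteq> {}" and g: "continuous_on S g" and h: "continuous_on S h"
    and X: "\<And>\<omega>. \<omega> \<in> space N \<Longrightarrow> X \<omega> \<in> S" and w0: "\<And>\<omega>. \<omega> \<in> space N \<Longrightarrow> 0 \<le> w \<omega>"
    and w: "integrable N w"
    and wg: "integrable N (\<lambda>\<omega>. w \<omega> * g (X \<omega>))" and wh: "integrable N (\<lambda>\<omega>. w \<omega> * h (X \<omega>))"
  shows "\<exists>a\<in>S. \<exists>b\<in>S. \<exists>\<theta>. 0 \<le> \<theta> \<and> \<theta> \<le> 1 \<and>
    (\<integral>\<omega>. w \<omega> * g (X \<omega>) \<partial>N) \<le> (\<integral>\<omega>. w \<omega> \<partial>N) * (\<theta> * g a + (1 - \<theta>) * g b) \<and>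
    (\<integral>\<omega>. w \<omega> \<partial>N) * (\<theta> * h a + (1 - \<theta>) * h b) \<le> (\<integral>\<omega>. w \<omega> * h (X \<omega>) \<partial>N)"
proof (cases "(\<integral>\<omega>. w \<omega> \<partial>N) = 0")
  case True
  have ae: "AE \<omega> in N. 0 \<le> w \<omega>" using w0 by auto
  have "AE \<omega> in N. w \<omega> = 0"
    using True integral_nonneg_eq_0_iff_AE[OF w ae] by simp
  then have null: "(\<integral>\<omega>. w \<omega> * f (X \<omega>) \<partial>N) = 0" for f :: "'a \<Rightarrow> real"
    by (intro integral_eq_zero_AE) auto
  obtain s where "s \<in> S" using S by auto
  then show ?thesis unfolding null True by (auto intro!: bexI[of _ s] exI[of _ 0])
next
  case False
  define W where "W = (\<integral>\<omega>. w \<omega> \<partial>N)"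
  have "0 \<le> W" unfolding W_def using w0 by (intro integral_nonneg_AE) auto
  then have W: "0 < W" using False by (simp add: W_def)
  define c where "c = (\<integral>\<omega>. w \<omega> * h (X \<omega>) \<partial>N) / W"
  have c: "(\<integral>\<omega>. w \<omega> * h (X \<omega>) \<partial>N) = W * c" using W by (simp add: c_def)
  have wc: "integrable N (\<lambda>\<omega>. w \<omega> * d)" "(\<integral>\<omega>. w \<omega> * d \<partial>N) = W * d" for d
    using w by (auto simp: W_def)
  obtain s where s: "s \<in> S" and s_min: "\<And>p. p \<in> S \<Longrightarrow> h s \<le> h p"
    using continuous_attains_inf[OF S h] by blast
  have "W * h s \<le> W * c"
    unfolding c[symmetric] wc(2)[of "h s", symmetric]
    by (intro integral_mono wc wh mult_left_mono s_min X w0)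
  then have sc: "h s \<le> c" using W by simp
  obtain a b \<theta> where ab: "a \<in> S" "b \<in> S" "0 \<le> \<theta>" "\<theta> \<le> 1" and mix_h: "\<theta> * h a + (1 - \<theta>) * h b \<le> c"
    and eq: "\<And>p. p \<in> S \<Longrightarrow> h p = c \<Longrightarrow> g p \<le> \<theta> * g a + (1 - \<theta>) * g b"
    and mult: "(\<exists>p\<in>S. h p < c) \<Longrightarrow>
      \<exists>l. \<forall>p\<in>S. g p - (\<theta> * g a + (1 - \<theta>) * g b) \<le> l * (h p - c)"
    using optimal_two_point_mixture_multiplier[OF S(1) g h s sc] by blast
  define V where "V = \<theta> * g a + (1 - \<theta>) * g b"
  have "(\<integral>\<omega>. w \<omega> * g (X \<omega>) \<partial>N) \<le> W * V"
  proof (cases "\<exists>p\<in>S. h p < c")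
    case True
    then obtain l where "\<forall>p\<in>S. g p - V \<le> l * (h p - c)"
      using mult unfolding V_def by blast
    then have l: "g p \<le> V + l * (h p - c)" if "p \<in> S" for p
      using that by (simp add: algebra_simps)
    have "(\<integral>\<omega>. w \<omega> * g (X \<omega>) \<partial>N) \<le> (\<integral>\<omega>. w \<omega> * V + l * (w \<omega> * h (X \<omega>) - w \<omega> * c) \<partial>N)"
    proof (intro integral_mono wg)
      show "integrable N (\<lambda>\<omega>. w \<omega> * V + l * (w \<omega> * h (X \<omega>) - w \<omega> * c))"
        by (intro Bochner_Integration.integrable_add Bochner_Integration.integrable_diff
            integrable_mult_right wc wh)
      show "w \<omega> * g (X \<omega>) \<le> w \<omega> * V + l * (w \<omega> * h (X \<omega>) - w \<omega> * c)" if "\<omega> \<in> space N" for \<omega>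
        using mult_left_mono[OF l[OF X[OF that]] w0[OF that]] by (simp add: algebra_simps)
    qed
    also have "\<dots> = W * V + l * (W * c - W * c)"
      using w wh c by (simp add: W_def[symmetric])
    finally show ?thesis by simp
  next
    case False
    \<comment> \<open>\<open>c\<close> is then both the minimum and the weighted mean of \<open>h\<close>\<close>
    have "(\<integral>\<omega>. w \<omega> * h (X \<omega>) - w \<omega> * c \<partial>N) = 0"
      using w wh c by (simp add: W_def[symmetric])
    moreover have "AE \<omega> in N. 0 \<le> w \<omega> * h (X \<omega>) - w \<omega> * c"
      using False X w0 by (intro AE_I2) (auto simp: not_less intro!: mult_left_mono)
    ultimately have "AE \<omega> in N. w \<omega> * h (X \<omega>) - w \<omega> * c = 0"
      using wc wh by (subst (asm) integral_nonneg_eq_0_iff_AE) auto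
    then have "AE \<omega> in N. w \<omega> * g (X \<omega>) \<le> w \<omega> * V"
    proof (rule AE_mp, intro AE_I2 impI)
      fix \<omega> assume \<omega>: "\<omega> \<in> space N" and "w \<omega> * h (X \<omega>) - w \<omega> * c = 0"
      then consider "w \<omega> = 0" | "h (X \<omega>) = c" by auto
      then show "w \<omega> * g (X \<omega>) \<le> w \<omega> * V"
        using eq[OF X[OF \<omega>]] w0[OF \<omega>] by cases (auto simp: V_def intro: mult_left_mono)
    qed
    then have "(\<integral>\<omega>. w \<omega> * g (X \<omega>) \<partial>N) \<le> (\<integral>\<omega>. w \<omega> * V \<partial>N)"
      by (intro integral_mono_AE wg wc)
    then show ?thesis by (simp only: wc(2))
  qed
  moreover have "W * (\<theta> * h a + (1 - \<theta>) * h b) \<le> W * c"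
    using mix_h W by simp
  ultimately show ?thesis
    using ab unfolding W_def[symmetric] c V_def by blast
qed

text \<open>
  Turns inequalities for single demand states into inequalities for the whole slot, over countably
  many demand states: partial integrals over finitely many fibres converge to the full integral.
\<close>

lemma integral_mono_on_fibres:
  fixes f g :: "'a \<Rightarrow> real" and Y :: "'a \<Rightarrow> 'y::countable"
  assumes f: "integrable N f" and g: "integrable N g" and Y: "Y \<in> N \<rightarrow>\<^sub>M count_space UNIV"
    and le: "\<And>y. (\<integral>\<omega>. indicator {y} (Y \<omega>) * f \<omega> \<partial>N) \<le> (\<integral>\<omega>. indicator {y} (Y \<omega>) * g \<omega> \<partial>N)"
  shows "(\<integral>\<omega>. f \<omega> \<partial>N) \<le> (\<integral>\<omega>. g \<omega> \<partial>N)"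
proof -
  define d where "d \<omega> = g \<omega> - f \<omega>" for \<omega>
  have d: "integrable N d" unfolding d_def using f g by simp
  define A where "A i = {\<omega> \<in> space N. to_nat (Y \<omega>) = i}" for i
  define B where "B n = (\<Union>i<n. A i)" for n
  have A_sets[measurable]: "A i \<in> sets N" for i
    unfolding A_def using Y by measurable
  have UB: "(\<Union>n. B n) = space N" by (auto simp: A_def B_def)
  have set_int: "set_integrable N (A i) d" for i
    unfolding set_integrable_def using d by (intro integrable_mult_indicator) auto
  have fibre: "0 \<le> (LINT \<omega>:A i|N. d \<omega>)" for i
  proof (cases "i \<in> range (to_nat :: 'y \<Rightarrow> nat)")
    case True
    then obtain y where i: "i = to_nat (y :: 'y)" by auto
    have int: "integrable N (\<lambda>\<omega>. indicator {y} (Y \<omega>) * \<phi> \<omega>)" if "integrable N \<phi>" for \<phi> :: "'a \<Rightarrow> real"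
    proof -
      have "integrable N (\<lambda>\<omega>. indicator (A i) \<omega> *\<^sub>R \<phi> \<omega>)"
        using that by (intro integrable_mult_indicator) auto
      then show ?thesis
        by (rule Bochner_Integration.integrable_cong[THEN iffD1, rotated -1]) (auto simp: A_def i indicator_def)
    qed
    have "(LINT \<omega>:A i|N. d \<omega>) = (\<integral>\<omega>. indicator {y} (Y \<omega>) * g \<omega> - indicator {y} (Y \<omega>) * f \<omega> \<partial>N)"
      unfolding set_lebesgue_integral_def d_def
      by (intro Bochner_Integration.integral_cong) (auto simp: A_def i indicator_def)
    then show ?thesis using le[of y] int[OF f] int[OF g] by simp
  next
    case False
    then have "A i = {}" by (auto simp: A_def)
    then show ?thesis by (simp add: set_lebesgue_integral_def)
  qed
  have "0 \<le> (LINT \<omega>:B n|N. d \<omega>)" for n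
  proof -
    have "(LINT \<omega>:B n|N. d \<omega>) = (\<Sum>i<n. LINT \<omega>:A i|N. d \<omega>)"
      unfolding B_def using set_int
      by (intro set_integral_finite_Union A_sets) (auto simp: disjoint_family_on_def A_def)
    then show ?thesis using fibre by (simp add: sum_nonneg)
  qed
  moreover have "(\<lambda>n. LINT \<omega>:B n|N. d \<omega>) \<longlonglongrightarrow> (LINT \<omega>:(\<Union>n. B n)|N. d \<omega>)"
  proof (rule set_integral_cont_up)
    show "incseq B" unfolding B_def incseq_def by (intro allI impI UN_mono) auto
    show "set_integrable N (\<Union>n. B n) d"
      unfolding UB set_integrable_def using d by (intro integrable_mult_indicator) auto
  qed (simp add: B_def)
  ultimately have "0 \<le> (LINT \<omega>:(\<Union>n. B n)|N. d \<omega>)"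
    by (intro LIMSEQ_le_const) auto
  also have "\<dots> = (\<integral>\<omega>. d \<omega> \<partial>N)"
    unfolding UB using d by (rule set_integral_space)
  finally show ?thesis unfolding d_def using f g by simp
qed

section \<open>Integration over the law of a slot\<close>

definition states_and_actions ::
    "nat \<Rightarrow> (nat \<Rightarrow> real set) \<Rightarrow> ('s \<times> ((nat \<Rightarrow> nat) \<times> (nat \<Rightarrow> real))) measure" where
  "states_and_actions K P = count_space UNIV \<Otimes>\<^sub>M action_space K P"

lemma space_action_spaceD:
  assumes "a \<in> space (action_space K P)" "k \<in> {1..K}"
  shows "fst a k \<in> {0, 1}" "snd a k \<in> P k"
  using assms by (auto simp: action_space_def space_pair_measure space_PiM space_restrict_space PiE_iff)

lemma measurable_offer:
  "k \<in> {1..K} \<Longrightarrow> (\<lambda>a. real (fst a k)) \<in> borel_measurable (action_space K P)"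
proof -
  assume "k \<in> {1..K}"
  then have "(\<lambda>a. fst a k) \<in> action_space K P \<rightarrow>\<^sub>M count_space {0, 1}"
    unfolding action_space_def
    by (intro measurable_compose[OF measurable_fst measurable_component_singleton])
  then show ?thesis by (rule measurable_compose) simp
qed

lemma measurable_price:
  "k \<in> {1..K} \<Longrightarrow> (\<lambda>a. snd a k) \<in> action_space K P \<rightarrow>\<^sub>M restrict_space borel (P k)"
  unfolding action_space_def
  by (rule measurable_compose[OF measurable_snd measurable_component_singleton])

lemma measurable_offer_times_price:
  assumes "k \<in> {1..K}" "f \<in> borel_measurable (restrict_space borel (P k))"
  shows "(\<lambda>a. real (fst a k) * f (snd a k)) \<in> borel_measurable (action_space K P)"
  by (intro borel_measurable_times measurable_offer assms
      measurable_compose[OF measurable_price[OF assms(1), of P] assms(2)])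

lemma abs_offer_times_le:
  assumes "k \<in> {1..K}" "a \<in> space (action_space K P)" "\<bar>v\<bar> \<le> B"
  shows "\<bar>real (fst a k) * v\<bar> \<le> B"
  using space_action_spaceD(1)[OF assms(2,1)] assms(3) by auto

lemma xy_only_policyD:
  assumes "xy_only_policy K P q"
  shows "prob_space (q s)" "sets (q s) = sets (action_space K P)"
proof -
  have "q s \<in> space (prob_algebra (action_space K P))"
    using assms unfolding xy_only_policy_def by (rule measurable_space) simp
  then show "prob_space (q s)" "sets (q s) = sets (action_space K P)"
    by (auto simp: space_prob_algebra)
qed

lemma slot_kernel_measurable:
  assumes q: "xy_only_policy K P q"
  shows "(\<lambda>s. return (count_space UNIV) s \<Otimes>\<^sub>M q s)
      \<in> count_space UNIV \<rightarrow>\<^sub>M prob_algebra (states_and_actions K P)"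
proof -
  have "prob_space (return (count_space UNIV) s \<Otimes>\<^sub>M q s)" for s
  proof -
    interpret pair_prob_space "return (count_space UNIV) s" "q s"
      using xy_only_policyD(1)[OF q] by (intro pair_prob_space.intro pair_sigma_finite.intro)
        (auto simp: prob_space_return prob_space_imp_sigma_finite)
    show ?thesis by unfold_locales
  qed
  moreover have "sets (return (count_space UNIV) s \<Otimes>\<^sub>M q s) = sets (states_and_actions K P)" for s
    unfolding states_and_actions_def
    by (intro sets_pair_measure_cong) (auto simp: xy_only_policyD(2)[OF q])
  ultimately show ?thesis by (simp add: space_prob_algebra)
qed

lemma slot_law_prob:
  assumes q: "xy_only_policy K P q"
  shows "prob_space (slot_law J q)" "sets (slot_law J q) = sets (states_and_actions K P)"
proof -
  have J: "measure_pmf J \<in> space (prob_algebra (count_space UNIV))"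
    by (simp add: space_prob_algebra prob_space_measure_pmf)
  show "prob_space (slot_law J q)" "sets (slot_law J q) = sets (states_and_actions K P)"
    unfolding slot_law_def
    by (rule prob_space_bind'[OF J slot_kernel_measurable[OF q]]
        sets_bind'[OF J slot_kernel_measurable[OF q]])+
qed

text \<open>
  Countability of the states makes measurability in the action for each fixed state enough for joint
  measurability.
\<close>

lemma integral_slot_law:
  fixes \<phi> :: "('x::countable \<times> 'y::countable) \<times> ((nat \<Rightarrow> nat) \<times> (nat \<Rightarrow> real)) \<Rightarrow> real"
  assumes q: "xy_only_policy K P q"
    and \<phi>: "\<And>s. (\<lambda>a. \<phi> (s, a)) \<in> borel_measurable (action_space K P)"
    and bound: "\<And>s a. a \<in> space (action_space K P) \<Longrightarrow> \<bar>\<phi> (s, a)\<bar> \<le> B"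
  shows "integrable (slot_law J q) \<phi>"
    "(\<integral>\<omega>. \<phi> \<omega> \<partial>slot_law J q) = (\<integral>s. \<integral>a. \<phi> (s, a) \<partial>q s \<partial>measure_pmf J)"
proof -
  have \<phi>'[measurable]: "\<phi> \<in> borel_measurable (states_and_actions K P)"
    unfolding states_and_actions_def by (intro measurable_pair_measure_countable1 \<phi>) auto
  have b: "\<bar>\<phi> \<omega>\<bar> \<le> B" if "\<omega> \<in> space (states_and_actions K P)" for \<omega>
    using that bound by (cases \<omega>) (auto simp: states_and_actions_def space_pair_measure)
  interpret L: prob_space "slot_law J q" using slot_law_prob(1)[OF q] .
  have sp: "space (slot_law J q) = space (states_and_actions K P)"
    by (rule sets_eq_imp_space_eq[OF slot_law_prob(2)[OF q]])
  show "integrable (slot_law J q) \<phi>"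
    using b slot_law_prob(2)[OF q] \<phi>'
    by (intro L.integrable_const_bound[of _ B]) (auto simp: sp cong: measurable_cong_sets)
  have kernel: "(\<lambda>s. return (count_space UNIV) s \<Otimes>\<^sub>M q s)
      \<in> measure_pmf J \<rightarrow>\<^sub>M subprob_algebra (states_and_actions K P)"
    using measurable_prob_algebraD[OF slot_kernel_measurable[OF q]] by simp
  have K1: "prob_space (return (count_space UNIV) s \<Otimes>\<^sub>M q s)"
      "sets (return (count_space UNIV) s \<Otimes>\<^sub>M q s) = sets (states_and_actions K P)" for s
    using measurable_space[OF slot_kernel_measurable[OF q], of s] by (auto simp: space_prob_algebra)
  have "(\<integral>\<omega>. \<phi> \<omega> \<partial>slot_law J q)
      = (\<integral>s. \<integral>\<omega>. \<phi> \<omega> \<partial>(return (count_space UNIV) s \<Otimes>\<^sub>M q s) \<partial>measure_pmf J)"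
    unfolding slot_law_def
    by (rule integral_bind[OF \<phi>' _ kernel measure_pmf.finite_measure_axioms, of B 1])
      (use b K1 in \<open>auto simp: prob_space.emeasure_space_1\<close>)
  also have "\<dots> = (\<integral>s. \<integral>a. \<phi> (s, a) \<partial>q s \<partial>measure_pmf J)"
  proof (intro Bochner_Integration.integral_cong refl)
    fix s :: "'x \<times> 'y"
    interpret pair_prob_space "return (count_space UNIV) s" "q s"
      using xy_only_policyD(1)[OF q] by (intro pair_prob_space.intro pair_sigma_finite.intro)
        (auto simp: prob_space_return prob_space_imp_sigma_finite)
    have "integrable (return (count_space UNIV) s \<Otimes>\<^sub>M q s) \<phi>"
      using b K1(2)[of s] \<phi>'
      by (intro P.integrable_const_bound[of _ B])
        (auto simp: sets_eq_imp_space_eq[OF K1(2)] cong: measurable_cong_sets)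
    from integral_fst'[OF this]
    show "(\<integral>\<omega>. \<phi> \<omega> \<partial>(return (count_space UNIV) s \<Otimes>\<^sub>M q s)) = (\<integral>a. \<phi> (s, a) \<partial>q s)"
      by (simp add: integral_return)
  qed
  finally show "(\<integral>\<omega>. \<phi> \<omega> \<partial>slot_law J q) = (\<integral>s. \<integral>a. \<phi> (s, a) \<partial>q s \<partial>measure_pmf J)" .
qed

text \<open>
  Revenue, demand, their restrictions to a demand state, and the means of a lottery all have the
  form offer times \<open>\<psi>\<close>, so one lemma
  gives integrability and iterated integrals under the law of a slot for all of them.
\<close>

lemma payoff_slot_law:
  fixes q :: "'x::countable \<times> 'y::countable \<Rightarrow> ((nat \<Rightarrow> nat) \<times> (nat \<Rightarrow> real)) measure"
    and \<psi> :: "real \<Rightarrow> 'y \<Rightarrow> real"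
  assumes q: "xy_only_policy K P q" and k: "k \<in> {1..K}"
    and cont: "\<And>y. continuous_on (P k) (\<lambda>p. \<psi> p y)"
    and B: "\<And>p y. p \<in> P k \<Longrightarrow> \<bar>\<psi> p y\<bar> \<le> B"
  shows "integrable (slot_law J q) (\<lambda>\<omega>. real (fst (snd \<omega>) k) * \<psi> (snd (snd \<omega>) k) (snd (fst \<omega>)))"
    and "(\<integral>\<omega>. real (fst (snd \<omega>) k) * \<psi> (snd (snd \<omega>) k) (snd (fst \<omega>)) \<partial>slot_law J q)
      = (\<integral>s. \<integral>\<omega>. real (fst \<omega> k) * \<psi> (snd \<omega> k) (snd s) \<partial>q s \<partial>measure_pmf J)"
proof -
  let ?\<phi> = "\<lambda>\<omega> :: ('x \<times> 'y) \<times> _. real (fst (snd \<omega>) k) * \<psi> (snd (snd \<omega>) k) (snd (fst \<omega>))"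
  have meas: "(\<lambda>a. ?\<phi> (s, a)) \<in> borel_measurable (action_space K P)" for s
    unfolding fst_conv snd_conv
    by (rule measurable_offer_times_price[OF k], rule borel_measurable_continuous_on_restrict[OF cont])
  have bound: "\<bar>?\<phi> (s, a)\<bar> \<le> B" if a: "a \<in> space (action_space K P)" for s a
    unfolding fst_conv snd_conv
    by (rule abs_offer_times_le[OF k a B[OF space_action_spaceD(2)[OF a k]]])
  show "integrable (slot_law J q) ?\<phi>"
    by (rule integral_slot_law(1)[OF q meas bound])
  show "(\<integral>\<omega>. ?\<phi> \<omega> \<partial>slot_law J q)
      = (\<integral>s. \<integral>\<omega>. real (fst \<omega> k) * \<psi> (snd \<omega> k) (snd s) \<partial>q s \<partial>measure_pmf J)"
    using integral_slot_law(2)[OF q meas bound, of J] by simp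
qed

section \<open>Redrawing prices from two-point lotteries\<close>

abbreviation unit_uniform :: "real measure" where
  "unit_uniform \<equiv> uniform_measure lborel {0..1}"

text \<open>
  One uniform variable drives the lotteries of all products. The prices of different products
  become dependent, but only the joint law of offer and price of a single product enters the
  objective and the constraints.
\<close>

definition redraw_prices ::
    "nat \<Rightarrow> (nat \<Rightarrow> real set) \<Rightarrow> (nat \<Rightarrow> real) \<Rightarrow> (nat \<Rightarrow> real) \<Rightarrow> (nat \<Rightarrow> real)
      \<Rightarrow> ((nat \<Rightarrow> nat) \<times> (nat \<Rightarrow> real)) measure \<Rightarrow> ((nat \<Rightarrow> nat) \<times> (nat \<Rightarrow> real)) measure" where
  "redraw_prices K P \<theta> a b Q =
     distr (Q \<Otimes>\<^sub>M unit_uniform) (action_space K P)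
       (\<lambda>\<omega>. (fst (fst \<omega>), \<lambda>k\<in>{1..K}. if snd \<omega> \<le> \<theta> k then a k else b k))"

lemma prob_space_unit_uniform: "prob_space unit_uniform"
  by (intro prob_space_uniform_measure) auto

lemma integral_coin:
  assumes "0 \<le> \<theta>" "\<theta> \<le> 1"
  shows "(\<integral>u. (if u \<le> \<theta> then c else d) \<partial>unit_uniform) = \<theta> * c + (1 - \<theta>) * (d::real)"
proof -
  interpret prob_space unit_uniform by (rule prob_space_unit_uniform)
  have "{0..1} \<inter> {..\<theta>} = {0..\<theta>}" using assms by auto
  then have meas: "measure unit_uniform {..\<theta>} = \<theta>" using assms by simp
  have "(\<integral>u. (if u \<le> \<theta> then c else d) \<partial>unit_uniform)
      = (\<integral>u. d + indicator {..\<theta>} u * (c - d) \<partial>unit_uniform)"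
    by (intro Bochner_Integration.integral_cong) auto
  also have "\<dots> = d + \<theta> * (c - d)"
    using integrable_real_indicator[of "{..\<theta>}" unit_uniform] emeasure_finite[of "{..\<theta>}"]
    by (subst Bochner_Integration.integral_add) (simp_all add: meas prob_space less_top)
  finally show ?thesis by (simp add: algebra_simps)
qed

context
  fixes K :: nat and P :: "nat \<Rightarrow> real set" and \<theta> a b :: "nat \<Rightarrow> real"
    and Q :: "((nat \<Rightarrow> nat) \<times> (nat \<Rightarrow> real)) measure"
  assumes Q: "prob_space Q" "sets Q = sets (action_space K P)"
    and ab: "\<And>k. k \<in> {1..K} \<Longrightarrow> a k \<in> P k" "\<And>k. k \<in> {1..K} \<Longrightarrow> b k \<in> P k"
    and \<theta>: "\<And>k. k \<in> {1..K} \<Longrightarrow> 0 \<le> \<theta> k" "\<And>k. k \<in> {1..K} \<Longrightarrow> \<theta> k \<le> 1"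
begin

lemma measurable_redraw:
  "(\<lambda>\<omega>. (fst (fst \<omega>), \<lambda>k\<in>{1..K}. if snd \<omega> \<le> \<theta> k then a k else b k))
     \<in> Q \<Otimes>\<^sub>M unit_uniform \<rightarrow>\<^sub>M action_space K P"
proof -
  let ?A = "\<Pi>\<^sub>M k\<in>{1..K}. restrict_space borel (P k)"
  have "(\<lambda>u. \<lambda>k\<in>{1..K}. if u \<le> \<theta> k then a k else b k) \<in> borel \<rightarrow>\<^sub>M ?A"
    using ab by (intro measurable_restrict measurable_restrict_space2) auto
  moreover have "snd \<in> action_space K P \<Otimes>\<^sub>M borel \<rightarrow>\<^sub>M (borel :: real measure)" by simp
  ultimately have "(\<lambda>\<omega>. \<lambda>k\<in>{1..K}. if snd \<omega> \<le> \<theta> k then a k else b k)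
      \<in> action_space K P \<Otimes>\<^sub>M borel \<rightarrow>\<^sub>M ?A"
    by (rule measurable_compose[rotated])
  moreover have "(\<lambda>\<omega>. fst (fst \<omega>)) \<in> action_space K P \<Otimes>\<^sub>M (borel :: real measure)
      \<rightarrow>\<^sub>M (\<Pi>\<^sub>M k\<in>{1..K}. count_space {0, 1})"
    unfolding action_space_def by measurable
  ultimately have "(\<lambda>\<omega>. (fst (fst \<omega>), \<lambda>k\<in>{1..K}. if snd \<omega> \<le> \<theta> k then a k else b k))
      \<in> action_space K P \<Otimes>\<^sub>M borel \<rightarrow>\<^sub>M action_space K P"
    by (subst (2) action_space_def) (rule measurable_Pair)
  moreover have "sets (Q \<Otimes>\<^sub>M unit_uniform) = sets (action_space K P \<Otimes>\<^sub>M (borel :: real measure))"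
    by (intro sets_pair_measure_cong Q) auto
  ultimately show ?thesis
    by (simp cong: measurable_cong_sets)
qed

interpretation pair_prob_space Q unit_uniform
  using Q(1) prob_space_unit_uniform
  by (intro pair_prob_space.intro pair_sigma_finite.intro) (auto simp: prob_space_imp_sigma_finite)

lemma redraw_prices_in_prob_algebra:
  "redraw_prices K P \<theta> a b Q \<in> space (prob_algebra (action_space K P))"
  unfolding redraw_prices_def space_prob_algebra
  using prob_space_distr[OF measurable_redraw] by simp

lemma AE_redraw_prices:
  assumes k: "k \<in> {1..K}"
  shows "AE (z, p) in redraw_prices K P \<theta> a b Q. p k \<in> {a k, b k}"
proof -
  have [measurable]: "(\<lambda>\<omega>. snd \<omega> k) \<in> action_space K P \<rightarrow>\<^sub>M borel"
    using measurable_price[OF k] by (simp add: measurable_restrict_space2_iff)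
  have "{\<omega> \<in> space (action_space K P). snd \<omega> k \<in> {a k, b k}} \<in> sets (action_space K P)"
    by measurable
  then have "(AE \<omega> in redraw_prices K P \<theta> a b Q. snd \<omega> k \<in> {a k, b k})"
    unfolding redraw_prices_def using k by (subst AE_distr_iff[OF measurable_redraw]) auto
  then show ?thesis by (simp add: case_prod_unfold)
qed

text \<open>The uniform variable is independent of the offers, so offer and lottery mean factor.\<close>

lemma integral_redraw_prices:
  assumes k: "k \<in> {1..K}" and f: "f \<in> borel_measurable (restrict_space borel (P k))"
  shows "(\<integral>\<omega>. real (fst \<omega> k) * f (snd \<omega> k) \<partial>redraw_prices K P \<theta> a b Q)
    = (\<integral>\<omega>. real (fst \<omega> k) * (\<theta> k * f (a k) + (1 - \<theta> k) * f (b k)) \<partial>Q)"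
proof -
  have offer: "(\<lambda>\<omega>. real (fst \<omega> k)) \<in> borel_measurable Q"
    using measurable_offer[OF k, of P] Q(2) by (simp cong: measurable_cong_sets)
  have sp: "space Q = space (action_space K P)" by (rule sets_eq_imp_space_eq[OF Q(2)])
  have payoff: "(\<lambda>\<omega>. real (fst \<omega> k) * f (snd \<omega> k)) \<in> borel_measurable (action_space K P)"
    using k f by (rule measurable_offer_times_price)
  define m where "m u = (if u \<le> \<theta> k then f (a k) else f (b k))" for u
  have m: "m \<in> borel_measurable unit_uniform" unfolding m_def by simp
  have "(\<integral>\<omega>. real (fst \<omega> k) * f (snd \<omega> k) \<partial>redraw_prices K P \<theta> a b Q)
      = (\<integral>\<omega>. real (fst (fst \<omega>) k) * m (snd \<omega>) \<partial>(Q \<Otimes>\<^sub>M unit_uniform))"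
    unfolding redraw_prices_def integral_distr[OF measurable_redraw payoff]
    by (rule Bochner_Integration.integral_cong) (use k in \<open>simp_all add: m_def\<close>)
  also have "\<dots> = (\<integral>\<omega>. \<integral>u. real (fst \<omega> k) * m u \<partial>unit_uniform \<partial>Q)"
  proof (subst integral_fst'[symmetric])
    show "integrable (Q \<Otimes>\<^sub>M unit_uniform) (\<lambda>\<omega>. real (fst (fst \<omega>) k) * m (snd \<omega>))"
    proof (rule P.integrable_const_bound)
      have "\<bar>real (fst (fst \<omega>) k) * m (snd \<omega>)\<bar> \<le> \<bar>f (a k)\<bar> + \<bar>f (b k)\<bar>"
        if "\<omega> \<in> space (Q \<Otimes>\<^sub>M unit_uniform)" for \<omega>
      proof -
        have "fst (fst \<omega>) k \<in> {0, 1}"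
          using that by (intro space_action_spaceD(1)[OF _ k]) (auto simp: space_pair_measure sp)
        then show ?thesis by (auto simp: m_def)
      qed
      then show "AE \<omega> in Q \<Otimes>\<^sub>M unit_uniform.
          norm (real (fst (fst \<omega>) k) * m (snd \<omega>)) \<le> \<bar>f (a k)\<bar> + \<bar>f (b k)\<bar>"
        by (intro AE_I2) simp
      show "(\<lambda>\<omega>. real (fst (fst \<omega>) k) * m (snd \<omega>)) \<in> borel_measurable (Q \<Otimes>\<^sub>M unit_uniform)"
        by (intro borel_measurable_times measurable_compose[OF measurable_fst offer]
            measurable_compose[OF measurable_snd m])
    qed
  qed simp
  also have "\<dots> = (\<integral>\<omega>. real (fst \<omega> k) * (\<theta> k * f (a k) + (1 - \<theta> k) * f (b k)) \<partial>Q)"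
    using integral_coin[OF \<theta>[OF k]] by (simp add: m_def)
  finally show ?thesis .
qed

end

lemma abs_mixture_le:
  fixes c d :: real
  assumes "\<bar>c\<bar> \<le> B" "\<bar>d\<bar> \<le> B" "0 \<le> \<theta>" "\<theta> \<le> 1"
  shows "\<bar>\<theta> * c + (1 - \<theta>) * d\<bar> \<le> B"
proof -
  have "\<bar>\<theta> * c + (1 - \<theta>) * d\<bar> \<le> \<theta> * \<bar>c\<bar> + (1 - \<theta>) * \<bar>d\<bar>"
    using assms by (intro order_trans[OF abs_triangle_ineq]) (simp add: abs_mult)
  also have "\<dots> \<le> B"
    using assms by (intro convex_bound_le) auto
  finally show ?thesis .
qed

text \<open>
  The lotteries see the demand state only, which is what the two-price condition asks for, while the
  offers keep depending on both states. The mean payoff under the redrawn policy is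
  expressed through the law of the original one, where the comparison takes place.
\<close>

lemma two_price_redraw_policy:
  fixes q :: "'x::countable \<times> 'y::countable \<Rightarrow> ((nat \<Rightarrow> nat) \<times> (nat \<Rightarrow> real)) measure"
  assumes q: "xy_only_policy K P q"
    and lottery: "\<forall>k\<in>{1..K}. \<forall>y. a k y \<in> P k \<and> b k y \<in> P k \<and> 0 \<le> \<theta> k y \<and> \<theta> k y \<le> 1"
  defines "q' \<equiv> \<lambda>s. redraw_prices K P (\<lambda>k. \<theta> k (snd s)) (\<lambda>k. a k (snd s)) (\<lambda>k. b k (snd s)) (q s)"
  shows "xy_only_policy K P q'" "uses_at_most_two_prices K P q'"
    and "\<And>k (\<phi> :: real \<Rightarrow> 'y \<Rightarrow> real) B. k \<in> {1..K} \<Longrightarrow> (\<And>y. continuous_on (P k) (\<lambda>p. \<phi> p y)) \<Longrightarrow>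
      (\<And>p y. p \<in> P k \<Longrightarrow> \<bar>\<phi> p y\<bar> \<le> B) \<Longrightarrow>
      (\<integral>\<omega>. real (fst (snd \<omega>) k) * \<phi> (snd (snd \<omega>) k) (snd (fst \<omega>)) \<partial>slot_law J q') =
      (\<integral>\<omega>. real (fst (snd \<omega>) k) * (\<theta> k (snd (fst \<omega>)) * \<phi> (a k (snd (fst \<omega>))) (snd (fst \<omega>))
         + (1 - \<theta> k (snd (fst \<omega>))) * \<phi> (b k (snd (fst \<omega>))) (snd (fst \<omega>))) \<partial>slot_law J q)"
proof -
  have ab: "\<And>k y. k \<in> {1..K} \<Longrightarrow> a k y \<in> P k" "\<And>k y. k \<in> {1..K} \<Longrightarrow> b k y \<in> P k"
    and \<theta>: "\<And>k y. k \<in> {1..K} \<Longrightarrow> 0 \<le> \<theta> k y" "\<And>k y. k \<in> {1..K} \<Longrightarrow> \<theta> k y \<le> 1"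
    using lottery by blast+
  show q': "xy_only_policy K P q'"
  proof -
    have "q' s \<in> space (prob_algebra (action_space K P))" for s
      unfolding q'_def
      by (rule redraw_prices_in_prob_algebra[OF xy_only_policyD[OF q, of s] ab(1)[of _ "snd s"] ab(2)[of _ "snd s"]
        \<theta>(1)[of _ "snd s"] \<theta>(2)[of _ "snd s"]])
    then show ?thesis unfolding xy_only_policy_def by simp
  qed
  show "uses_at_most_two_prices K P q'"
    unfolding uses_at_most_two_prices_def
  proof (intro exI[of _ "\<lambda>k y. {a k y, b k y}"] ballI allI conjI)
    fix k :: nat and y :: 'y and x :: 'x
    assume k: "k \<in> {1..K}"
    show "AE (z, p) in q' (x, y). p k \<in> {a k y, b k y}"
      unfolding q'_def snd_conv
      by (rule AE_redraw_prices[OF xy_only_policyD[OF q, of "(x, y)"] ab(1)[of _ y] ab(2)[of _ y]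
        \<theta>(1)[of _ y] \<theta>(2)[of _ y] k])
  qed (use ab in \<open>auto simp: card_insert_if\<close>)
  fix k :: nat and \<phi> :: "real \<Rightarrow> 'y \<Rightarrow> real" and B :: real
  assume k: "k \<in> {1..K}" and cont: "\<And>y. continuous_on (P k) (\<lambda>p. \<phi> p y)"
    and B: "\<And>p y. p \<in> P k \<Longrightarrow> \<bar>\<phi> p y\<bar> \<le> B"
  define mix where "mix y = \<theta> k y * \<phi> (a k y) y + (1 - \<theta> k y) * \<phi> (b k y) y" for y
  have mix_bound: "\<bar>mix y\<bar> \<le> B" for y
    unfolding mix_def by (intro abs_mixture_le B ab \<theta> k)
  have meas: "(\<lambda>p. \<phi> p y) \<in> borel_measurable (restrict_space borel (P k))" for y
    by (rule borel_measurable_continuous_on_restrict[OF cont])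
  have "(\<integral>\<omega>. real (fst (snd \<omega>) k) * \<phi> (snd (snd \<omega>) k) (snd (fst \<omega>)) \<partial>slot_law J q')
      = (\<integral>s. \<integral>\<omega>. real (fst \<omega> k) * \<phi> (snd \<omega> k) (snd s) \<partial>q' s \<partial>measure_pmf J)"
    by (rule payoff_slot_law(2)[OF q' k cont B])
  also have "\<dots> = (\<integral>s. \<integral>\<omega>. real (fst \<omega> k) * mix (snd s) \<partial>q s \<partial>measure_pmf J)"
    unfolding q'_def mix_def
  proof (rule Bochner_Integration.integral_cong[OF refl])
    fix s
    show "(\<integral>\<omega>. real (fst \<omega> k) * \<phi> (snd \<omega> k) (snd s)
          \<partial>redraw_prices K P (\<lambda>k. \<theta> k (snd s)) (\<lambda>k. a k (snd s)) (\<lambda>k. b k (snd s)) (q s))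
        = (\<integral>\<omega>. real (fst \<omega> k) * (\<theta> k (snd s) * \<phi> (a k (snd s)) (snd s)
            + (1 - \<theta> k (snd s)) * \<phi> (b k (snd s)) (snd s)) \<partial>q s)"
      by (rule integral_redraw_prices[OF xy_only_policyD[OF q, of s] ab(1)[of _ "snd s"] ab(2)[of _ "snd s"]
        \<theta>(1)[of _ "snd s"] \<theta>(2)[of _ "snd s"] k meas])
  qed
  also have "\<dots> = (\<integral>\<omega>. real (fst (snd \<omega>) k) * mix (snd (fst \<omega>)) \<partial>slot_law J q)"
    by (rule payoff_slot_law(2)[OF q k, symmetric]) (auto intro: mix_bound)
  finally show "(\<integral>\<omega>. real (fst (snd \<omega>) k) * \<phi> (snd (snd \<omega>) k) (snd (fst \<omega>)) \<partial>slot_law J q') =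
      (\<integral>\<omega>. real (fst (snd \<omega>) k) * (\<theta> k (snd (fst \<omega>)) * \<phi> (a k (snd (fst \<omega>))) (snd (fst \<omega>))
         + (1 - \<theta> k (snd (fst \<omega>))) * \<phi> (b k (snd (fst \<omega>))) (snd (fst \<omega>))) \<partial>slot_law J q)"
    unfolding mix_def .
qed

section \<open>Two prices per product and demand state suffice\<close>

lemma abs_bounded_demand_mean_le:
  assumes "set_pmf d \<subseteq> {0..n}"
  shows "\<bar>measure_pmf.expectation d real\<bar> \<le> real n"
proof -
  have ae: "AE i in measure_pmf d. real i \<le> real n"
    using assms by (auto simp: AE_measure_pmf_iff)
  then have int: "integrable (measure_pmf d) real"
    by (intro measure_pmf.integrable_const_bound[of _ "real n"]) auto
  have "0 \<le> measure_pmf.expectation d real" by simp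
  then show ?thesis using measure_pmf.integral_le_const[OF int ae] by simp
qed

theorem theorem2:
  fixes M K :: nat
    and \<beta> :: "nat \<Rightarrow> nat \<Rightarrow> nat"
    and \<alpha> :: "nat \<Rightarrow> real"
    and J :: "('x::countable \<times> 'y::countable) pmf"
    and P :: "nat \<Rightarrow> real set"
    and Dmax :: "nat \<Rightarrow> nat"
    and demand :: "nat \<Rightarrow> real \<Rightarrow> 'y \<Rightarrow> nat pmf"
    and F :: "nat \<Rightarrow> real \<Rightarrow> 'y \<Rightarrow> real"
    and rhat :: real
    and muhat :: "nat \<Rightarrow> real"
  assumes alpha_nonneg: "\<And>k. k \<in> {1..K} \<Longrightarrow> 0 \<le> \<alpha> k"
    and prices_compact: "\<And>k. k \<in> {1..K} \<Longrightarrow> compact (P k)"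
    and prices_nonneg: "\<And>k. k \<in> {1..K} \<Longrightarrow> P k \<subseteq> {0..}"
    and demand_bounded:
      "\<And>k p y. k \<in> {1..K} \<Longrightarrow> p \<in> P k \<Longrightarrow> set_pmf (demand k p y) \<subseteq> {0..Dmax k}"
    and F_eq:
      "\<And>k p y. k \<in> {1..K} \<Longrightarrow> p \<in> P k \<Longrightarrow> F k p y = measure_pmf.expectation (demand k p y) real"
    and F_cont: "\<And>k y. k \<in> {1..K} \<Longrightarrow> continuous_on (P k) (\<lambda>p. F k p y)"
    and policy:
      "\<exists>q. xy_only_policy K P q \<and>
        (\<Sum>k=1..K. \<integral>((x, y), (z, p)). real (z k) * (p k - \<alpha> k) * F k (p k) y \<partial>slot_law J q) \<ge> rhat \<and>
        (\<forall>m\<in>{1..M}. (\<Sum>k=1..K. real (\<beta> m k) *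
            (\<integral>((x, y), (z, p)). real (z k) * F k (p k) y \<partial>slot_law J q)) \<le> muhat m)"
  shows
      "\<exists>q. xy_only_policy K P q \<and> uses_at_most_two_prices K P q \<and>
        (\<Sum>k=1..K. \<integral>((x, y), (z, p)). real (z k) * (p k - \<alpha> k) * F k (p k) y \<partial>slot_law J q) \<ge> rhat \<and>
        (\<forall>m\<in>{1..M}. (\<Sum>k=1..K. real (\<beta> m k) *
            (\<integral>((x, y), (z, p)). real (z k) * F k (p k) y \<partial>slot_law J q)) \<le> muhat m)"
proof -
  obtain q where q: "xy_only_policy K P q"
    and rev: "(\<Sum>k=1..K. \<integral>((x, y), (z, p)). real (z k) * (p k - \<alpha> k) * F k (p k) y \<partial>slot_law J q) \<ge> rhat"
    and use: "\<forall>m\<in>{1..M}. (\<Sum>k=1..K. real (\<beta> m k) *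
        (\<integral>((x, y), (z, p)). real (z k) * F k (p k) y \<partial>slot_law J q)) \<le> muhat m"
    using policy by blast
  define G where "G k p y = (p - \<alpha> k) * F k p y" for k p y
  have G_cont: "continuous_on (P k) (\<lambda>p. G k p y)" if "k \<in> {1..K}" for k y
    unfolding G_def by (intro continuous_intros F_cont that)
  have F_bound: "\<bar>F k p y\<bar> \<le> real (Dmax k)" if "k \<in> {1..K}" "p \<in> P k" for k p y
    unfolding F_eq[OF that] by (rule abs_bounded_demand_mean_le[OF demand_bounded[OF that]])
  have "\<exists>B. \<forall>p\<in>P k. \<forall>y. \<bar>G k p y\<bar> \<le> B" if k: "k \<in> {1..K}" for k
  proof -
    have "compact ((\<lambda>p. p - \<alpha> k) ` P k)"
      by (intro compact_continuous_image continuous_intros prices_compact k)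
    then have "bounded ((\<lambda>p. p - \<alpha> k) ` P k)" by (rule compact_imp_bounded)
    then obtain R where R: "\<And>p. p \<in> P k \<Longrightarrow> \<bar>p - \<alpha> k\<bar> \<le> R"
      by (auto simp: bounded_iff)
    have "\<bar>G k p y\<bar> \<le> R * real (Dmax k)" if p: "p \<in> P k" for p y
      unfolding G_def abs_mult using R[OF p] F_bound[OF k p, of y]
      by (intro mult_mono) auto
    then show ?thesis by blast
  qed
  then obtain C where G_bound: "\<bar>G k p y\<bar> \<le> C k" if "k \<in> {1..K}" "p \<in> P k" for k p y
    by metis

  have space_slot: "snd \<omega> \<in> space (action_space K P)" if "\<omega> \<in> space (slot_law J q)" for \<omega>
    using that sets_eq_imp_space_eq[OF slot_law_prob(2)[OF q]]
    by (auto simp: states_and_actions_def space_pair_measure)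
  have P_nonempty: "P k \<noteq> {}" if "k \<in> {1..K}" for k
    using prob_space.not_empty[OF slot_law_prob(1)[OF q]] space_slot space_action_spaceD(2)[OF _ that]
    by blast
  note payoff = payoff_slot_law(1)[OF q]
  have F_payoff: "integrable (slot_law J q)
      (\<lambda>\<omega>. real (fst (snd \<omega>) k) * F k (snd (snd \<omega>) k) (snd (fst \<omega>)))" if "k \<in> {1..K}" for k
    by (rule payoff[OF that F_cont[OF that] F_bound[OF that]])
  have G_payoff: "integrable (slot_law J q)
      (\<lambda>\<omega>. real (fst (snd \<omega>) k) * G k (snd (snd \<omega>) k) (snd (fst \<omega>)))" if "k \<in> {1..K}" for k
    by (rule payoff[OF that G_cont[OF that] G_bound[OF that]])

  define on_demand where "on_demand y \<omega> = (indicator {y} (snd (fst \<omega>)) :: real)"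
    for y and \<omega> :: "('x \<times> 'y) \<times> (nat \<Rightarrow> nat) \<times> (nat \<Rightarrow> real)"
  define offered where "offered k y = (\<integral>\<omega>. on_demand y \<omega> * real (fst (snd \<omega>) k) \<partial>slot_law J q)" for k y
  have fibre_payoff: "integrable (slot_law J q)
      (\<lambda>\<omega>. on_demand y \<omega> * real (fst (snd \<omega>) k) * \<phi> (snd (snd \<omega>) k))"
    if k: "k \<in> {1..K}" and cont: "continuous_on (P k) \<phi>" and B: "\<And>p. p \<in> P k \<Longrightarrow> \<bar>\<phi> p\<bar> \<le> B"
    for k y \<phi> and B :: real
  proof -
    have "integrable (slot_law J q)
        (\<lambda>\<omega>. real (fst (snd \<omega>) k) * (indicator {y} (snd (fst \<omega>)) * \<phi> (snd (snd \<omega>) k)))"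
    proof (rule payoff[OF k])
      show "continuous_on (P k) (\<lambda>p. indicator {y} y' * \<phi> p)" for y'
        by (intro continuous_intros cont)
      show "\<bar>indicator {y} y' * \<phi> p\<bar> \<le> B" if "p \<in> P k" for p y'
        using B[OF that] by (auto simp: indicator_def)
    qed
    then show ?thesis by (simp add: on_demand_def mult_ac)
  qed
  \<comment> \<open>the revenue is to go up and the demand down, at the same probability of offering in state \<open>y\<close>\<close>
  define better where "better k y a b \<theta> \<longleftrightarrow> a \<in> P k \<and> b \<in> P k \<and> 0 \<le> \<theta> \<and> \<theta> \<le> 1 \<and>
      (\<integral>\<omega>. on_demand y \<omega> * real (fst (snd \<omega>) k) * G k (snd (snd \<omega>) k) y \<partial>slot_law J q)
        \<le> offered k y * (\<theta> * G k a y + (1 - \<theta>) * G k b y) \<and>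
      offered k y * (\<theta> * F k a y + (1 - \<theta>) * F k b y)
        \<le> (\<integral>\<omega>. on_demand y \<omega> * real (fst (snd \<omega>) k) * F k (snd (snd \<omega>) k) y \<partial>slot_law J q)"
    for k y a b \<theta>
  have "\<exists>a b \<theta>. better k y a b \<theta>"
    if k: "k \<in> {1..K}" for k y
  proof -
    have "\<exists>a\<in>P k. \<exists>b\<in>P k. \<exists>\<theta>. 0 \<le> \<theta> \<and> \<theta> \<le> 1 \<and>
      (\<integral>\<omega>. on_demand y \<omega> * real (fst (snd \<omega>) k) * G k (snd (snd \<omega>) k) y \<partial>slot_law J q)
        \<le> offered k y * (\<theta> * G k a y + (1 - \<theta>) * G k b y) \<and>
      offered k y * (\<theta> * F k a y + (1 - \<theta>) * F k b y)
        \<le> (\<integral>\<omega>. on_demand y \<omega> * real (fst (snd \<omega>) k) * F k (snd (snd \<omega>) k) y \<partial>slot_law J q)"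
      unfolding offered_def
      \<comment> \<open>the weight confines the law of the slot to demand state \<open>y\<close>, for all supply states together\<close>
    proof (rule two_point_mixture_dominates_weighted_mean)
      show "snd (snd \<omega>) k \<in> P k" if "\<omega> \<in> space (slot_law J q)" for \<omega>
        by (rule space_action_spaceD(2)[OF space_slot[OF that] k])
      show "integrable (slot_law J q) (\<lambda>\<omega>. on_demand y \<omega> * real (fst (snd \<omega>) k))"
        using fibre_payoff[OF k, of "\<lambda>_. 1" 1] by simp
      show "integrable (slot_law J q) (\<lambda>\<omega>. on_demand y \<omega> * real (fst (snd \<omega>) k) * G k (snd (snd \<omega>) k) y)"
        by (rule fibre_payoff[OF k G_cont[OF k] G_bound[OF k]])
      show "integrable (slot_law J q) (\<lambda>\<omega>. on_demand y \<omega> * real (fst (snd \<omega>) k) * F k (snd (snd \<omega>) k) y)"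
        by (rule fibre_payoff[OF k F_cont[OF k] F_bound[OF k]])
    qed (use prices_compact[OF k] P_nonempty[OF k] F_cont[OF k] G_cont[OF k] in \<open>simp_all add: on_demand_def\<close>)
    then show ?thesis unfolding better_def by blast
  qed
  then have "\<forall>k y. \<exists>a b \<theta>. k \<in> {1..K} \<longrightarrow> better k y a b \<theta>" by blast
  then obtain a b \<theta> where "\<forall>k y. k \<in> {1..K} \<longrightarrow> better k y (a k y) (b k y) (\<theta> k y)" by metis
  then have better: "better k y (a k y) (b k y) (\<theta> k y)" if "k \<in> {1..K}" for k y
    using that by blast
  have lottery: "\<forall>k\<in>{1..K}. \<forall>y. a k y \<in> P k \<and> b k y \<in> P k \<and> 0 \<le> \<theta> k y \<and> \<theta> k y \<le> 1"
    using better unfolding better_def by blast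
  define mix where "mix \<phi> k y = \<theta> k y * \<phi> k (a k y) y + (1 - \<theta> k y) * \<phi> k (b k y) y"
    for \<phi> :: "nat \<Rightarrow> real \<Rightarrow> 'y \<Rightarrow> real" and k y
  define q' where "q' s = redraw_prices K P (\<lambda>k. \<theta> k (snd s)) (\<lambda>k. a k (snd s)) (\<lambda>k. b k (snd s)) (q s)"
    for s
  note redraw = two_price_redraw_policy[where a = a and b = b and \<theta> = \<theta>, OF q lottery, folded q'_def]

  have mix_payoff: "integrable (slot_law J q) (\<lambda>\<omega>. real (fst (snd \<omega>) k) * mix \<phi> k (snd (fst \<omega>)))"
    if k: "k \<in> {1..K}" and B: "\<And>p y. p \<in> P k \<Longrightarrow> \<bar>\<phi> k p y\<bar> \<le> B" for k \<phi> and B :: real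
    unfolding mix_def by (rule payoff[OF k, where B = B])
      (use lottery k B in \<open>auto intro!: abs_mixture_le\<close>)
  have demand_state: "(\<lambda>\<omega>. snd (fst \<omega>)) \<in> slot_law J q \<rightarrow>\<^sub>M count_space UNIV"
  proof -
    have "(\<lambda>\<omega>. snd (fst \<omega>)) \<in> states_and_actions K P \<rightarrow>\<^sub>M (count_space UNIV :: 'y measure)"
      unfolding states_and_actions_def by (rule measurable_compose[OF measurable_fst]) simp
    then show ?thesis unfolding measurable_cong_sets[OF slot_law_prob(2)[OF q] refl] .
  qed
  have fibre_eq: "(\<integral>\<omega>. indicator {y} (snd (fst \<omega>)) * (real (fst (snd \<omega>) k) * \<psi> \<omega> (snd (fst \<omega>))) \<partial>slot_law J q)
      = (\<integral>\<omega>. on_demand y \<omega> * real (fst (snd \<omega>) k) * \<psi> \<omega> y \<partial>slot_law J q)" for y k \<psi>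
    by (rule Bochner_Integration.integral_cong) (auto simp: on_demand_def indicator_def)
  have fibre_mix: "(\<integral>\<omega>. indicator {y} (snd (fst \<omega>)) * (real (fst (snd \<omega>) k) * mix \<phi> k (snd (fst \<omega>))) \<partial>slot_law J q)
      = offered k y * mix \<phi> k y" for y k \<phi>
    unfolding fibre_eq[of _ _ "\<lambda>_. mix \<phi> k"] offered_def by (rule integral_mult_left_zero)

  have revenue: "(\<integral>((x, y), (z, p)). real (z k) * (p k - \<alpha> k) * F k (p k) y \<partial>slot_law J q)
      \<le> (\<integral>((x, y), (z, p)). real (z k) * (p k - \<alpha> k) * F k (p k) y \<partial>slot_law J q')"
    if k: "k \<in> {1..K}" for k
  proof -
    have "(\<integral>\<omega>. real (fst (snd \<omega>) k) * G k (snd (snd \<omega>) k) (snd (fst \<omega>)) \<partial>slot_law J q)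
        \<le> (\<integral>\<omega>. real (fst (snd \<omega>) k) * mix G k (snd (fst \<omega>)) \<partial>slot_law J q)"
    proof (rule integral_mono_on_fibres[OF G_payoff[OF k] mix_payoff[where \<phi> = G, OF k G_bound[OF k]] demand_state])
      fix y
      show "(\<integral>\<omega>. indicator {y} (snd (fst \<omega>)) * (real (fst (snd \<omega>) k) * G k (snd (snd \<omega>) k) (snd (fst \<omega>))) \<partial>slot_law J q)
        \<le> (\<integral>\<omega>. indicator {y} (snd (fst \<omega>)) * (real (fst (snd \<omega>) k) * mix G k (snd (fst \<omega>))) \<partial>slot_law J q)"
        unfolding fibre_mix fibre_eq[of _ _ "\<lambda>\<omega>. G k (snd (snd \<omega>) k)"]
        using better[OF k, of y] unfolding mix_def better_def by blast
    qed
    also have "\<dots> = (\<integral>\<omega>. real (fst (snd \<omega>) k) * G k (snd (snd \<omega>) k) (snd (fst \<omega>)) \<partial>slot_law J q')"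
      unfolding mix_def by (rule redraw(3)[where \<phi> = "G k", OF k G_cont[OF k] G_bound[OF k], symmetric])
    finally show ?thesis by (simp add: G_def case_prod_unfold mult.assoc)
  qed
  have usage: "(\<integral>((x, y), (z, p)). real (z k) * F k (p k) y \<partial>slot_law J q')
      \<le> (\<integral>((x, y), (z, p)). real (z k) * F k (p k) y \<partial>slot_law J q)"
    if k: "k \<in> {1..K}" for k
  proof -
    have "(\<integral>\<omega>. real (fst (snd \<omega>) k) * F k (snd (snd \<omega>) k) (snd (fst \<omega>)) \<partial>slot_law J q')
        = (\<integral>\<omega>. real (fst (snd \<omega>) k) * mix F k (snd (fst \<omega>)) \<partial>slot_law J q)"
      unfolding mix_def by (rule redraw(3)[where \<phi> = "F k", OF k F_cont[OF k] F_bound[OF k]])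
    also have "\<dots> \<le> (\<integral>\<omega>. real (fst (snd \<omega>) k) * F k (snd (snd \<omega>) k) (snd (fst \<omega>)) \<partial>slot_law J q)"
    proof (rule integral_mono_on_fibres[OF mix_payoff[where \<phi> = F, OF k F_bound[OF k]] F_payoff[OF k] demand_state])
      fix y
      show "(\<integral>\<omega>. indicator {y} (snd (fst \<omega>)) * (real (fst (snd \<omega>) k) * mix F k (snd (fst \<omega>))) \<partial>slot_law J q)
        \<le> (\<integral>\<omega>. indicator {y} (snd (fst \<omega>)) * (real (fst (snd \<omega>) k) * F k (snd (snd \<omega>) k) (snd (fst \<omega>))) \<partial>slot_law J q)"
        unfolding fibre_mix fibre_eq[of _ _ "\<lambda>\<omega>. F k (snd (snd \<omega>) k)"]
        using better[OF k, of y] unfolding mix_def better_def by blast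
    qed
    finally show ?thesis by (simp add: case_prod_unfold)
  qed
  show ?thesis
  proof (intro exI[of _ q'] conjI ballI)
    show "rhat \<le> (\<Sum>k=1..K. \<integral>((x, y), (z, p)). real (z k) * (p k - \<alpha> k) * F k (p k) y \<partial>slot_law J q')"
      by (rule order_trans[OF rev sum_mono[OF revenue]])
    show "(\<Sum>k=1..K. real (\<beta> m k) * (\<integral>((x, y), (z, p)). real (z k) * F k (p k) y \<partial>slot_law J q')) \<le> muhat m"
      if "m \<in> {1..M}" for m
      by (rule order_trans[OF sum_mono[OF mult_left_mono[OF usage]] bspec[OF use that]]) auto
  qed (fact redraw(1), fact redraw(2))
qed

end
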